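(* Let $m\in\mathbb{N}$, $\alpha_0,\alpha_1,a>0$, let $H=K^*K-\nu\Delta\in\mathbb{R}^{m\times m}$ be positive definite, let $\mathbb{A}:\mathbb{R}^{5m}\to\mathbb{R}^{3m}$ be linear, $b\in\mathbb{R}^{3m}$, and let $f_0$ be a fixed vector. For $\xi=(\lambda,\mu)\in\mathbb{R}^{2m}\times\mathbb{R}^{3m}$ put $$\mathfrak{D}(\xi)=h(\mathbb{A}\xi-b)+g(\lambda)+\psi(\mu),\qquad h(v_1,v_2)=\tfrac12\langle H^{-1}v_1,v_1\rangle-\tfrac12\|f_0\|_2^2+\tfrac1{2a}\|v_2\|_2^2\quad (v_1\in\mathbb{R}^m,\ v_2\in\mathbb{R}^{2m}),$$ where $g$ is the indicator function of $\{\lambda:|\lambda_i|\le\alpha_1,\ i=1,\dots,m\}$ and $\psi$ is the indicator function of $\{\mu:|\mu_i|\le\alpha_0,\ i=1,\dots,m\}$. Consider the problem $\max_\xi-\mathfrak{D}(\xi)$, and suppose it has at least one solution $\bar\xi=(\bar\lambda,\bar\mu)$ satisfying the following assumption: (i) for each $i=1,\dots,m$, either $\bar\lambda_i\in\operatorname{int}\mathbb{B}_{\alpha_1,\Lambda}(0)$, or $\bar\lambda_i\in\operatorname{bd}\mathbb{B}_{\alpha_1,\Lambda}(0)$ and there exists $\bar g_i\ne0$ such that $\bar g_i\in\mathcal{N}_{\mathbb{B}_{\alpha_1,\Lambda}(0)}(\bar\lambda_i)$; (ii) for each $i=1,\dots,m$, either $\bar\mu_i\in\operatorname{int}\mathbb{B}_{\alpha_0,M}(0)$,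 or $\bar\mu_i\in\operatorname{bd}\mathbb{B}_{\alpha_0,M}(0)$ and there exists $\bar\psi_i\ne0$ such that $\bar\psi_i\in\mathcal{N}_{\mathbb{B}_{\alpha_0,M}(0)}(\bar\mu_i)$. Then $\partial\mathfrak{D}$ is metrically subregular at $(\bar\lambda,\bar\mu)$ for the origin.
   Context: Notation: $\lambda=(\lambda_1,\dots,\lambda_m)$ with $\lambda_i=(\lambda_i^1,\lambda_i^2)\in\mathbb{R}^2$, $|\lambda_i|=\sqrt{(\lambda_i^1)^2+(\lambda_i^2)^2}$; $\mu=(\mu_1,\dots,\mu_m)$ with $\mu_i=(\mu_i^1,\mu_i^2,\mu_i^3)\in\mathbb{R}^3$, $|\mu_i|=\sqrt{(\mu_i^1)^2+(\mu_i^2)^2+2(\mu_i^3)^2}$. The closed balls are $\mathbb{B}_{\alpha_1,\Lambda}(0)=\{\tilde\lambda\in\mathbb{R}^2:|\tilde\lambda|\le\alpha_1\}$ and $\mathbb{B}_{\alpha_0,M}(0)=\{\tilde\mu\in\mathbb{R}^3:|\tilde\mu|\le\alpha_0\}$; $\operatorname{int}$ and $\operatorname{bd}$ denote interior and boundary; $\mathcal{N}_C(x)$ is the normal cone of the convex set $C$ at $x$; $\partial$ is the convex subdifferential. The pointwise inner products are $\lambda^1s^1+\lambda^2s^2$ on $\mathbb{R}^2$ and $\mu^1r^1+\mu^2r^2+2\mu^3r^3$ on $\mathbb{R}^3$, inducing $|\cdot|$. The indicator function of a set is $0$ on the set and $+\infty$ outside. $K$ is a linear operator, $\Delta$ the discrete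 Laplacian ($-\Delta=\nabla^*\nabla$ with $\nabla$ the forward-difference gradient), and $\nu=0$ if $K^*K$ is positive definite, $\nu>0$ otherwise. Metric subregularity: a set-valued map $F:X\rightrightarrows Y$ is metrically subregular at $\bar x$ for $\bar y$ if $\bar y\in F(\bar x)$ and there exist a modulus $\kappa\ge0$ and neighborhoods $U$ of $\bar x$ and $V$ of $\bar y$ such that $\operatorname{dist}(x,F^{-1}(\bar y))\le\kappa\,\operatorname{dist}(\bar y,F(x)\cap V)$ for all $x\in U$, where $\operatorname{dist}(x,C)=\inf\{\|x-x'\|:x'\in C\}$. The problem contains as a special case the dual of total generalized variation (TGV) regularized image restoration.
   Formalization: In (i) and (ii) the nonzero normals ḡ_i, ψ̄_i are required to be the components of (ḡ,ψ̄) = −∇(h(𝔸·−b))(ξ̄) (strict complementarity); with arbitrary nonzero normals the conditions always hold and the claim is false. *)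

theory Defs
  imports "HOL-Analysis.Analysis"
begin

section \<open>Triples with weighted inner product\<close>

text \<open>
  The pointwise dual variables \<open>\<mu>\<^sub>i = (\<mu>\<^sub>i\<^sup>1, \<mu>\<^sub>i\<^sup>2, \<mu>\<^sub>i\<^sup>3)\<close> are vectors of three reals, but with inner
  product \<open>\<mu>\<^sup>1r\<^sup>1 + \<mu>\<^sup>2r\<^sup>2 + 2\<mu>\<^sup>3r\<^sup>3\<close> (symmetric 2 by 2 matrices, the off-diagonal entry counted twice).
  With a type of its own, the library notions of norm, distance, ball, gradient etc., also
  on vectors and pairs over this type, all refer to the weighted inner product.
\<close>

datatype sym2 = Sym2 (c1: real) (c2: real) (c3: real)

lemma sym2_eq_iff: "x = y \<longleftrightarrow> c1 x = c1 y \<and> c2 x = c2 y \<and> c3 x = c3 y"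
  by (cases x; cases y) simp

instantiation sym2 :: ab_group_add
begin

definition "0 = Sym2 0 0 0"
definition "x + y = Sym2 (c1 x + c1 y) (c2 x + c2 y) (c3 x + c3 y)" for x y :: sym2
definition "- x = Sym2 (- c1 x) (- c2 x) (- c3 x)" for x :: sym2
definition "x - y = Sym2 (c1 x - c1 y) (c2 x - c2 y) (c3 x - c3 y)" for x y :: sym2

instance
  by standard
    (simp_all add: zero_sym2_def plus_sym2_def uminus_sym2_def minus_sym2_def)

end

lemma sym2_sel_simps [simp]:
  "c1 0 = 0" "c2 0 = 0" "c3 0 = 0"
  "c1 (x + y) = c1 x + c1 y" "c2 (x + y) = c2 x + c2 y" "c3 (x + y) = c3 x + c3 y"
  "c1 (- x) = - c1 x" "c2 (- x) = - c2 x" "c3 (- x) = - c3 x"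
  "c1 (x - y) = c1 x - c1 y" "c2 (x - y) = c2 x - c2 y" "c3 (x - y) = c3 x - c3 y"
  by (simp_all add: zero_sym2_def plus_sym2_def uminus_sym2_def minus_sym2_def)

instantiation sym2 :: real_vector
begin

definition "scaleR r x = Sym2 (r * c1 x) (r * c2 x) (r * c3 x)"

instance
  by standard (simp_all add: scaleR_sym2_def sym2_eq_iff algebra_simps)

end

lemma sym2_sel_scaleR [simp]:
  "c1 (r *\<^sub>R x) = r * c1 x" "c2 (r *\<^sub>R x) = r * c2 x" "c3 (r *\<^sub>R x) = r * c3 x"
  by (simp_all add: scaleR_sym2_def)

instantiation sym2 :: real_inner
begin

definition inner_sym2_def: "inner x y = c1 x * c1 y + c2 x * c2 y + 2 * (c3 x * c3 y)"

definition norm_sym2_def: "norm x = sqrt ((c1 x)\<^sup>2 + (c2 x)\<^sup>2 + 2 * (c3 x)\<^sup>2)"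

definition sgn_sym2_def: "sgn x = x /\<^sub>R norm x" for x :: sym2

definition dist_sym2_def: "dist x y = norm (x - y)" for x y :: sym2

definition uniformity_sym2_def [code del]:
  "(uniformity :: (sym2 \<times> sym2) filter) = (INF e\<in>{0 <..}. principal {(x, y). dist x y < e})"

definition open_sym2_def [code del]:
  "open (U :: sym2 set) \<longleftrightarrow> (\<forall>x\<in>U. eventually (\<lambda>(x', y). x' = x \<longrightarrow> y \<in> U) uniformity)"

instance
proof
  fix x y z :: sym2 and r :: real and U :: "sym2 set"
  show "dist x y = norm (x - y)"
    by (rule dist_sym2_def)
  show "sgn x = x /\<^sub>R norm x"
    by (rule sgn_sym2_def)
  show "(uniformity :: (sym2 \<times> sym2) filter) = (INF e\<in>{0 <..}. principal {(x, y). dist x y < e})"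
    by (rule uniformity_sym2_def)
  show "open U \<longleftrightarrow> (\<forall>x\<in>U. eventually (\<lambda>(x', y). x' = x \<longrightarrow> y \<in> U) uniformity)"
    by (rule open_sym2_def)
  show "inner x y = inner y x"
    by (simp add: inner_sym2_def mult.commute)
  show "inner (x + y) z = inner x z + inner y z"
    by (simp add: inner_sym2_def algebra_simps)
  show "inner (r *\<^sub>R x) y = r * inner x y"
    by (simp add: inner_sym2_def algebra_simps)
  show "0 \<le> inner x x"
    by (simp add: inner_sym2_def)
  show "inner x x = 0 \<longleftrightarrow> x = 0"
    by (simp add: inner_sym2_def sym2_eq_iff[of x 0] add_nonneg_eq_0_iff)
  show "norm x = sqrt (inner x x)"
    by (simp add: norm_sym2_def inner_sym2_def power2_eq_square)
qed

end

instantiation sym2 :: euclidean_space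
begin

definition Basis_sym2_def: "Basis = {Sym2 1 0 0, Sym2 0 1 0, Sym2 0 0 (1 / sqrt 2)}"

instance
proof
  show "(Basis :: sym2 set) \<noteq> {}" "finite (Basis :: sym2 set)"
    by (simp_all add: Basis_sym2_def)
next
  fix u v :: sym2
  define r where "r = 1 / sqrt 2"
  have r: "2 * (r * r) = 1" "r \<noteq> 0"
    by (simp_all add: r_def)
  have B: "(Basis :: sym2 set) = {Sym2 1 0 0, Sym2 0 1 0, Sym2 0 0 r}"
    by (simp only: Basis_sym2_def r_def)
  assume "u \<in> Basis" "v \<in> Basis"
  then have "u = Sym2 1 0 0 \<or> u = Sym2 0 1 0 \<or> u = Sym2 0 0 r"
      "v = Sym2 1 0 0 \<or> v = Sym2 0 1 0 \<or> v = Sym2 0 0 r"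
    by (simp_all only: B insert_iff empty_iff simp_thms)
  then show "inner u v = (if u = v then 1 else 0)"
    using r by (elim disjE) (simp_all add: inner_sym2_def)
next
  fix x :: sym2
  show "(\<forall>u\<in>Basis. inner x u = 0) \<longleftrightarrow> x = 0"
    by (simp add: Basis_sym2_def inner_sym2_def sym2_eq_iff[of x 0])
qed

end


section \<open>Convex analysis and metric subregularity\<close>

definition normal_cone :: "'a::real_inner set \<Rightarrow> 'a \<Rightarrow> 'a set" where
  "normal_cone C x = {v. x \<in> C \<and> (\<forall>y\<in>C. v \<bullet> (y - x) \<le> 0)}"

definition subdifferential :: "('a::real_inner \<Rightarrow> ereal) \<Rightarrow> 'a \<Rightarrow> 'a set" where
  "subdifferential f x = {p. \<bar>f x\<bar> \<noteq> \<infinity> \<and> (\<forall>y. f x + ereal (p \<bullet> (y - x)) \<le> f y)}"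

definition indicat_ereal :: "'a set \<Rightarrow> 'a \<Rightarrow> ereal" where
  "indicat_ereal S x = (if x \<in> S then 0 else \<infinity>)"

text \<open>
  In contrast to \<^const>\<open>infdist\<close>, the distance to the empty set is \<open>\<infinity>\<close>.
\<close>

definition edist_set :: "'a::metric_space \<Rightarrow> 'a set \<Rightarrow> ereal" where
  "edist_set x C = (INF x'\<in>C. ereal (dist x x'))"

text \<open>
  The convention \<open>0 * \<infinity> = 0\<close> of type \<^typ>\<open>ereal\<close> is harmless in the following definition:
  whenever the inequality holds with \<open>\<kappa> = 0\<close>, under either reading of \<open>0 * \<infinity>\<close>, it also holds
  with \<open>\<kappa> = 1\<close>.
\<close>

definition metrically_subregular ::
    "('a::metric_space \<Rightarrow> 'b::metric_space set) \<Rightarrow> 'a \<Rightarrow> 'b \<Rightarrow> bool" where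
  "metrically_subregular F xb yb \<longleftrightarrow>
     yb \<in> F xb \<and>
     (\<exists>\<kappa>::real. \<kappa> \<ge> 0 \<and>
       (\<exists>U V. xb \<in> interior U \<and> yb \<in> interior V \<and>
         (\<forall>x\<in>U. edist_set x {x'. yb \<in> F x'} \<le> ereal \<kappa> * edist_set yb (F x \<inter> V))))"


section \<open>The discrete operators\<close>

text \<open>
  An image with pixel set \<^typ>\<open>'m\<close> is a vector \<open>u :: real^'m\<close>; an injective map
  \<open>px :: 'm \<Rightarrow> nat \<times> nat\<close> whose range is a rectangle \<open>{..<N1} \<times> {..<N2}\<close> places the pixels on a
  grid. Forward differences leaving the grid are zero (Neumann boundary).
\<close>

definition fwd_diff :: "('m \<Rightarrow> nat \<times> nat) \<Rightarrow> real^'m \<Rightarrow> 'm \<Rightarrow> nat \<times> nat \<Rightarrow> real" where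
  "fwd_diff px u p q = (if q \<in> range px then u $ (inv px q) - u $ p else 0)"

definition dgrad :: "('m::finite \<Rightarrow> nat \<times> nat) \<Rightarrow> real^'m \<Rightarrow> real^2^'m" where
  "dgrad px u = (\<chi> p. vector
     [fwd_diff px u p (Suc (fst (px p)), snd (px p)),
      fwd_diff px u p (fst (px p), Suc (snd (px p)))])"

definition dlaplace :: "('m::finite \<Rightarrow> nat \<times> nat) \<Rightarrow> real^'m \<Rightarrow> real^'m" where
  "dlaplace px u = - adjoint (dgrad px) (dgrad px u)"

definition pos_definite :: "('a::real_inner \<Rightarrow> 'a) \<Rightarrow> bool" where
  "pos_definite T \<longleftrightarrow>
     linear T \<and> (\<forall>x y. T x \<bullet> y = x \<bullet> T y) \<and> (\<forall>x. x \<noteq> 0 \<longrightarrow> T x \<bullet> x > 0)"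

definition H_op ::
    "(real^'m \<Rightarrow> real^'k) \<Rightarrow> real \<Rightarrow> ('m::finite \<Rightarrow> nat \<times> nat) \<Rightarrow> real^'m \<Rightarrow> real^'m" where
  "H_op K \<nu> px u = adjoint K (K u) - \<nu> *\<^sub>R dlaplace px u"


section \<open>The dual objective\<close>

definition dual_h ::
    "(real^'m \<Rightarrow> real^'m) \<Rightarrow> real^'k \<Rightarrow> real \<Rightarrow> (real^'m) \<times> (real^2^'m) \<Rightarrow> real" where
  "dual_h H f0 a = (\<lambda>(v1, v2).
     1/2 * (inv H v1 \<bullet> v1) - 1/2 * (norm f0)\<^sup>2 + 1/(2 * a) * (norm v2)\<^sup>2)"

definition dual_objective ::
    "(real^'m \<Rightarrow> real^'m) \<Rightarrow> real^'k \<Rightarrow> real \<Rightarrow> real \<Rightarrow> real \<Rightarrow>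
     ((real^2^'m) \<times> (sym2^'m) \<Rightarrow> (real^'m) \<times> (real^2^'m)) \<Rightarrow> (real^'m) \<times> (real^2^'m) \<Rightarrow>
     (real^2^'m) \<times> (sym2^'m) \<Rightarrow> ereal" where
  "dual_objective H f0 a \<alpha>0 \<alpha>1 A b = (\<lambda>(l, m).
     ereal (dual_h H f0 a (A (l, m) - b))
     + indicat_ereal {l. \<forall>i. norm (l $ i) \<le> \<alpha>1} l
     + indicat_ereal {m. \<forall>i. norm (m $ i) \<le> \<alpha>0} m)"

end

theory Submission
  imports Defs
begin

text \<open>
  Write the objective as \<open>\<phi> + indicator of C\<close>, with \<open>C\<close> a product of balls and
  \<open>\<phi> \<xi> = q (A \<xi> - b) + const\<close> for a positive definite quadratic form \<open>q\<close>, and let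
  \<open>w = - \<nabla>\<phi> xb\<close> at the given minimizer \<open>xb\<close>. Call a component active if \<open>xb\<close> lies on the
  boundary of the ball there.

  The hypothesis is strict complementarity: \<open>w\<close> is a nonzero normal vector in each active component, and optimality
  forces \<open>w\<close> to vanish in the others. Euclidean balls are strongly convex: inside the
  ball, the linear functional given by a nonzero normal vector at a boundary point falls below its
  value there by a multiple of the squared distance (\<open>normal_cone_cball_strong\<close>). So on \<open>C\<close> the linear part of \<open>\<phi>\<close> grows
  quadratically in the active components, while \<open>q\<close> grows quadratically in \<open>A (\<xi> - xb)\<close>. Hence
  every point \<open>x\<close> of \<open>C\<close> near \<open>xb\<close> should be compared with the affine space of all points that
  share with \<open>xb\<close> the value of \<open>A\<close> and all active components. Near \<open>xb\<close> this space
  stays inside \<open>C\<close>, because only inactive components vary, and \<open>\<phi>\<close> is constant on it, so that it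
  consists of minimizers there.

  For \<open>x'\<close> the orthogonal projection of \<open>x\<close> onto this space, \<open>norm (x - x')\<close> is bounded by a
  multiple of the violation of the linear equations (\<open>affine_error_bound\<close>), which gives quadratic
  growth \<open>\<phi> x - \<phi> x' \<ge> c * (norm (x - x'))\<^sup>2\<close>. A subgradient \<open>v\<close> at \<open>x\<close> bounds the left
  side by \<open>norm v * norm (x - x')\<close>, and cancelling one factor \<open>norm (x - x')\<close> is metric
  subregularity (\<open>subdifferential_quadratic_growth_imp_subregular\<close>).
\<close>

section \<open>Quadratic growth and metric subregularity\<close>

lemma edist_set_le_scaled:
  assumes "\<kappa> > 0" and "\<And>v. v \<in> T \<Longrightarrow> edist_set x S \<le> ereal (\<kappa> * dist y v)"
  shows "edist_set x S \<le> ereal \<kappa> * edist_set y T"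
proof -
  have "edist_set x S / ereal \<kappa> \<le> edist_set y T"
    unfolding edist_set_def[of y T]
  proof (rule INF_greatest)
    fix v assume "v \<in> T"
    then have "edist_set x S \<le> ereal \<kappa> * ereal (dist y v)"
      using assms(2) by simp
    then show "edist_set x S / ereal \<kappa> \<le> ereal (dist y v)"
      using assms(1) by (subst ereal_divide_le_pos) auto
  qed
  then show ?thesis
    using assms(1) by (subst (asm) ereal_divide_le_pos) auto
qed

text \<open>
  The growth is measured against a minimizer \<open>x'\<close> that may depend on \<open>x\<close>. Combined with the
  subgradient inequality from \<open>x\<close> to \<open>x'\<close> it reads
  \<open>c * (norm (x - x'))\<^sup>2 \<le> v \<bullet> (x - x')\<close>, and Cauchy--Schwarz finishes the proof. As this
  holds for every subgradient \<open>v\<close> at \<open>x\<close>, the neighbourhood of the origin is the whole space.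
\<close>

lemma subdifferential_quadratic_growth_imp_subregular:
  fixes D :: "'a::real_inner \<Rightarrow> ereal"
  assumes "0 \<in> subdifferential D xb" and "c > 0" and "r > 0"
    and growth: "\<And>x. dist xb x < r \<Longrightarrow> \<bar>D x\<bar> \<noteq> \<infinity> \<Longrightarrow>
      \<exists>x'. 0 \<in> subdifferential D x' \<and> D x' + ereal (c * (norm (x - x'))\<^sup>2) \<le> D x"
  shows "metrically_subregular (subdifferential D) xb 0"
proof -
  let ?S = "{x'. 0 \<in> subdifferential D x'}"
  have bound: "edist_set x ?S \<le> ereal (1 / c) * edist_set 0 (subdifferential D x \<inter> UNIV)"
    if x: "x \<in> ball xb r" for x
  proof (rule edist_set_le_scaled)
    fix v assume v: "v \<in> subdifferential D x \<inter> UNIV"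
    then have fin: "\<bar>D x\<bar> \<noteq> \<infinity>"
      by (simp add: subdifferential_def)
    obtain x' where x': "0 \<in> subdifferential D x'"
      and g: "D x' + ereal (c * (norm (x - x'))\<^sup>2) \<le> D x"
      using growth[OF _ fin] x by auto
    have fin': "\<bar>D x'\<bar> \<noteq> \<infinity>"
      using x' by (simp add: subdifferential_def)
    have "D x + ereal (v \<bullet> (x' - x)) \<le> D x'"
      using v by (simp add: subdifferential_def)
    with g fin fin' have "c * (norm (x - x'))\<^sup>2 \<le> v \<bullet> (x - x')"
      by (cases "D x"; cases "D x'") (auto simp: inner_diff_right)
    also have "\<dots> \<le> norm v * norm (x - x')"
      by (rule norm_cauchy_schwarz)
    finally have "(c * norm (x - x')) * norm (x - x') \<le> norm v * norm (x - x')"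
      by (simp add: power2_eq_square mult.assoc)
    then have "c * norm (x - x') \<le> norm v"
      by (cases "x = x'") auto
    then have "dist x x' \<le> 1 / c * dist 0 v"
      using \<open>c > 0\<close> by (simp add: field_simps dist_norm)
    moreover have "edist_set x ?S \<le> ereal (dist x x')"
      unfolding edist_set_def using x' by (intro INF_lower) simp
    ultimately show "edist_set x ?S \<le> ereal (1 / c * dist 0 v)"
      by (metis ereal_less_eq(3) order_trans)
  qed (use \<open>c > 0\<close> in simp)
  show ?thesis
    unfolding metrically_subregular_def
  proof (intro conjI exI)
    show "0 \<le> 1 / c" using \<open>c > 0\<close> by simp
    show "xb \<in> interior (ball xb r)" using \<open>r > 0\<close> by simp
    show "0 \<in> interior (UNIV :: 'a set)" by simp
    show "\<forall>x\<in>ball xb r. edist_set x ?S \<le> ereal (1 / c) * edist_set 0 (subdifferential D x \<inter> UNIV)"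
      using bound by blast
  qed (fact assms(1))
qed

lemma zero_in_subdifferential_indicator_sum_iff:
  "0 \<in> subdifferential (\<lambda>x. ereal (\<phi> x) + indicat_ereal C x) x \<longleftrightarrow>
     x \<in> C \<and> (\<forall>y\<in>C. \<phi> x \<le> \<phi> y)"
  by (auto simp: subdifferential_def indicat_ereal_def)

section \<open>Normal vectors to balls\<close>

text \<open>
  Testing normality at the point of the sphere in direction \<open>w\<close> yields equality in Cauchy--Schwarz,
  so \<open>w\<close> is a nonnegative multiple of \<open>y\<close>. The estimate is then the identity
  \<open>2 * (y \<bullet> (y - x)) = (norm (y - x))\<^sup>2 + (norm y)\<^sup>2 - (norm x)\<^sup>2\<close>.
\<close>

lemma normal_cone_cball_strong:
  fixes x y w :: "'v::real_inner"
  assumes w: "w \<in> normal_cone (cball 0 \<alpha>) y" and y: "norm y = \<alpha>" and x: "norm x \<le> \<alpha>"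
  shows "norm w * (norm (y - x))\<^sup>2 \<le> 2 * \<alpha> * (w \<bullet> (y - x))"
proof (cases "w = 0")
  case False
  have "0 \<le> \<alpha>" using y by auto
  have "w \<bullet> ((\<alpha> / norm w) *\<^sub>R w - y) \<le> 0"
    using w False \<open>0 \<le> \<alpha>\<close> by (auto simp: normal_cone_def)
  moreover have "w \<bullet> ((\<alpha> / norm w) *\<^sub>R w) = \<alpha> * norm w"
    using False by (simp add: power2_norm_eq_inner[symmetric] power2_eq_square)
  ultimately have "norm w * norm y \<le> w \<bullet> y"
    using y by (simp add: inner_diff_right mult.commute)
  then have "w \<bullet> y = norm w * norm y"
    using norm_cauchy_schwarz[of w y] by simp
  then have "norm w *\<^sub>R y = norm y *\<^sub>R w"
    by (simp only: norm_cauchy_schwarz_eq)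
  then have dir: "\<alpha> *\<^sub>R w = norm w *\<^sub>R y"
    using y by simp
  have "2 * \<alpha> * (w \<bullet> (y - x)) = 2 * ((\<alpha> *\<^sub>R w) \<bullet> (y - x))"
    by simp
  also have "\<dots> = norm w * (2 * (y \<bullet> y - y \<bullet> x))"
    unfolding dir by (simp add: inner_diff_right algebra_simps)
  also have "\<dots> \<ge> norm w * (norm (y - x))\<^sup>2"
  proof (rule mult_left_mono)
    have "x \<bullet> x \<le> y \<bullet> y"
      using x y by (metis norm_le)
    then show "(norm (y - x))\<^sup>2 \<le> 2 * (y \<bullet> y - y \<bullet> x)"
      by (simp add: power2_norm_eq_inner inner_diff_left inner_diff_right inner_commute)
  qed simp
  finally show ?thesis .
qed simp

text \<open>
  Setting the other components to zero, rather than restricting the index set, keeps the map linear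
  on one fixed vector space.
\<close>

definition active_part :: "'i set \<Rightarrow> 'v::zero^'i::finite \<Rightarrow> 'v^'i" where
  "active_part I x = (\<chi> i. if i \<in> I then x $ i else 0)"

lemma linear_active_part: "linear (active_part I :: 'v::real_vector^'i \<Rightarrow> _)"
  by (rule linearI) (auto simp: active_part_def vec_eq_iff)

lemma active_part_eq_iff: "active_part I x = active_part I y \<longleftrightarrow> (\<forall>i\<in>I. x $ i = y $ i)"
  by (auto simp: active_part_def vec_eq_iff)

text \<open>
  Summing the estimate for a single ball: the constant is the least of the finitely many factors
  \<open>norm (w $ i) / (2 * \<alpha>)\<close>, which is positive because \<open>w\<close> vanishes in no active component. Inactive
  components contribute nothing to either side.
\<close>

lemma ball_product_strong_normal:
  fixes xb w :: "'v::euclidean_space^'i::finite"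
  assumes "\<alpha> > 0"
    and normal: "\<And>i. i \<in> I \<Longrightarrow> norm (xb $ i) = \<alpha> \<and> w $ i \<noteq> 0 \<and> w $ i \<in> normal_cone (cball 0 \<alpha>) (xb $ i)"
    and zero: "\<And>i. i \<notin> I \<Longrightarrow> w $ i = 0"
  shows "\<exists>c>0. \<forall>x x'. (\<forall>i. norm (x $ i) \<le> \<alpha>) \<longrightarrow> active_part I x' = active_part I xb \<longrightarrow>
           c * (norm (active_part I (x - x')))\<^sup>2 \<le> w \<bullet> (x' - x)"
proof -
  \<comment> \<open>The \<open>1\<close> only keeps the minimum defined when no component is active.\<close>
  define c where "c = Min (insert 1 ((\<lambda>i. norm (w $ i) / (2 * \<alpha>)) ` I))"
  have "c > 0"
    unfolding c_def using normal \<open>\<alpha> > 0\<close> by (subst Min_gr_iff) auto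
  have c_le: "c \<le> norm (w $ i) / (2 * \<alpha>)" if "i \<in> I" for i
    unfolding c_def using that by (intro Min_le) auto
  have "c * (norm (active_part I (x - x')))\<^sup>2 \<le> w \<bullet> (x' - x)"
    if x: "\<forall>i. norm (x $ i) \<le> \<alpha>" and x': "active_part I x' = active_part I xb" for x x'
  proof -
    have "c * (norm (active_part I (x - x')))\<^sup>2 = (\<Sum>i\<in>UNIV. c * (norm (active_part I (x - x') $ i))\<^sup>2)"
      by (simp add: power2_norm_eq_inner inner_vec_def sum_distrib_left)
    also have "\<dots> \<le> (\<Sum>i\<in>UNIV. w $ i \<bullet> (x' - x) $ i)"
    proof (rule sum_mono)
      fix i
      show "c * (norm (active_part I (x - x') $ i))\<^sup>2 \<le> w $ i \<bullet> (x' - x) $ i"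
      proof (cases "i \<in> I")
        case True
        have "c * (norm (xb $ i - x $ i))\<^sup>2 \<le> norm (w $ i) / (2 * \<alpha>) * (norm (xb $ i - x $ i))\<^sup>2"
          using c_le[OF True] by (rule mult_right_mono) simp
        also have "\<dots> \<le> w $ i \<bullet> (xb $ i - x $ i)"
          using normal_cone_cball_strong[of "w $ i" \<alpha> "xb $ i" "x $ i"] normal[OF True] x \<open>\<alpha> > 0\<close>
          by (simp add: field_simps)
        finally show ?thesis
          using True x' by (simp add: active_part_eq_iff) (simp add: active_part_def norm_minus_commute)
      next
        case False
        then show ?thesis by (simp add: active_part_def zero)
      qed
    qed
    finally show ?thesis by (simp add: inner_vec_def)
  qed
  then show ?thesis using \<open>c > 0\<close> by blast
qed

text \<open>
  Points that agree with \<open>xb\<close> in the active components can leave the product of balls only through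
  an inactive one, where \<open>xb\<close> has some distance from the boundary.
\<close>

lemma ball_product_neighbourhood:
  fixes xb :: "'v::real_normed_vector^'i::finite"
  assumes bd: "\<And>i. norm (xb $ i) \<le> \<alpha>" and int: "\<And>i. i \<notin> I \<Longrightarrow> norm (xb $ i) < \<alpha>"
  shows "\<exists>r>0. \<forall>x. norm (x - xb) < r \<longrightarrow> active_part I x = active_part I xb \<longrightarrow> (\<forall>i. norm (x $ i) \<le> \<alpha>)"
proof -
  define r where "r = Min (insert 1 ((\<lambda>i. \<alpha> - norm (xb $ i)) ` (- I)))"
  have "r > 0"
    unfolding r_def using int by (subst Min_gr_iff) auto
  have r_le: "r \<le> \<alpha> - norm (xb $ i)" if "i \<notin> I" for i
    unfolding r_def using that by (intro Min_le) auto
  have "norm (x $ i) \<le> \<alpha>" if x: "norm (x - xb) < r" and m: "active_part I x = active_part I xb" for x i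
  proof (cases "i \<in> I")
    case True
    then show ?thesis using m bd by (simp add: active_part_eq_iff)
  next
    case False
    have "norm (x $ i) \<le> norm (xb $ i) + norm ((x - xb) $ i)"
      using norm_triangle_ineq[of "xb $ i" "(x - xb) $ i"] by simp
    also have "norm ((x - xb) $ i) \<le> norm (x - xb)"
      by (rule Finite_Cartesian_Product.norm_nth_le)
    finally show ?thesis using x r_le[OF False] by simp
  qed
  then show ?thesis using \<open>r > 0\<close> by blast
qed

text \<open>
  From an interior component one can move a little in direction \<open>w $ i\<close>, and a normal vector has
  nonpositive inner product with this admissible move.
\<close>

lemma normal_component_zero_at_interior:
  fixes xb w :: "'v::real_inner^'i::finite"
  assumes w: "\<And>y. (\<forall>i. norm (y $ i) \<le> \<alpha>) \<Longrightarrow> w \<bullet> (y - xb) \<le> 0"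
    and bd: "\<And>i. norm (xb $ i) \<le> \<alpha>" and int: "norm (xb $ i) < \<alpha>"
  shows "w $ i = 0"
proof (rule ccontr)
  assume "w $ i \<noteq> 0"
  \<comment> \<open>The largest step that the triangle inequality allows.\<close>
  define t where "t = (\<alpha> - norm (xb $ i)) / norm (w $ i)"
  have "t > 0" unfolding t_def using int \<open>w $ i \<noteq> 0\<close> by simp
  define y where "y = xb + axis i (t *\<^sub>R w $ i)"
  have "norm (y $ j) \<le> \<alpha>" for j
  proof (cases "j = i")
    case True
    have "norm (t *\<^sub>R w $ i) = \<alpha> - norm (xb $ i)"
      using int \<open>w $ i \<noteq> 0\<close> by (simp add: t_def)
    then show ?thesis
      using True norm_triangle_ineq[of "xb $ i" "t *\<^sub>R w $ i"] by (simp add: y_def axis_def)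
  qed (use bd in \<open>simp add: y_def axis_def\<close>)
  then have "w \<bullet> (y - xb) \<le> 0" by (intro w) simp
  then have "t * (w $ i \<bullet> w $ i) \<le> 0"
    by (simp add: y_def inner_axis)
  moreover have "w $ i \<bullet> w $ i > 0"
    using \<open>w $ i \<noteq> 0\<close> by simp
  ultimately show False
    using mult_pos_pos[OF \<open>t > 0\<close>] by (meson not_less)
qed

section \<open>Positive definite quadratic forms\<close>

text \<open>
  By homogeneity the minimum of the quadratic form over the compact unit sphere is a valid constant.
\<close>

lemma pos_definite_coercive:
  fixes T :: "'a::euclidean_space \<Rightarrow> 'a"
  assumes "pos_definite T"
  shows "\<exists>c>0. \<forall>x. c * (norm x)\<^sup>2 \<le> T x \<bullet> x"
proof -
  have lin: "linear T" using assms by (simp add: pos_definite_def)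
  have "continuous_on (sphere 0 1) (\<lambda>x. T x \<bullet> x)"
    using lin by (intro continuous_intros linear_continuous_on) (simp add: linear_conv_bounded_linear)
  moreover have "sphere 0 1 \<noteq> ({} :: 'a set)"
    by (simp add: sphere_eq_empty)
  ultimately obtain z where z: "z \<in> sphere 0 1" and min: "\<forall>x\<in>sphere 0 1. T z \<bullet> z \<le> T x \<bullet> x"
    using continuous_attains_inf[OF compact_sphere] by blast
  have pos: "T z \<bullet> z > 0"
  proof -
    have "z \<noteq> 0" using z by auto
    then show ?thesis using assms unfolding pos_definite_def by blast
  qed
  have "(T z \<bullet> z) * (norm x)\<^sup>2 \<le> T x \<bullet> x" for x
  proof (cases "x = 0")
    case False
    have "T z \<bullet> z \<le> T (x /\<^sub>R norm x) \<bullet> (x /\<^sub>R norm x)"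
      using False by (intro min[rule_format]) simp
    also have "\<dots> = (T x \<bullet> x) / (norm x)\<^sup>2"
      using lin by (simp add: linear_cmul power2_eq_square field_simps)
    finally show ?thesis using False by (simp add: field_simps)
  qed simp
  then show ?thesis using pos by blast
qed

lemma pos_definite_bij:
  fixes T :: "'a::euclidean_space \<Rightarrow> 'a"
  assumes "pos_definite T"
  shows "bij T"
proof -
  have lin: "linear T" using assms by (simp add: pos_definite_def)
  have "x = 0" if "T x = 0" for x
    using assms that unfolding pos_definite_def by (metis inner_zero_left less_irrefl)
  then have "inj T" using lin by (simp add: linear_injective_0)
  then show ?thesis using lin by (simp add: bij_def linear_inj_imp_surj)
qed

lemma pos_definite_inv:
  fixes T :: "'a::euclidean_space \<Rightarrow> 'a"
  assumes "pos_definite T"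
  shows "pos_definite (inv T)"
proof -
  have lin: "linear T" and sym: "\<And>x y. T x \<bullet> y = x \<bullet> T y"
    and pos: "\<And>x. x \<noteq> 0 \<Longrightarrow> T x \<bullet> x > 0"
    using assms unfolding pos_definite_def by blast+
  have bij: "bij T" by (rule pos_definite_bij[OF assms])
  then have inv: "T (inv T x) = x" for x
    by (simp add: bij_is_surj surj_f_inv_f)
  have "linear (inv T)"
    using lin bij_is_inj[OF bij] by (rule inj_linear_imp_inv_linear)
  moreover have "inv T x \<bullet> y = x \<bullet> inv T y" for x y
    using sym[of "inv T x" "inv T y"] inv by simp
  moreover have "inv T x \<bullet> x > 0" if "x \<noteq> 0" for x
  proof -
    have "inv T x \<noteq> 0" using inv[of x] that lin linear_0 by fastforce
    then show ?thesis using pos[of "inv T x"] inv by (simp add: inner_commute)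
  qed
  ultimately show ?thesis by (simp add: pos_definite_def)
qed

definition dual_hessian ::
    "(real^'m \<Rightarrow> real^'m) \<Rightarrow> real \<Rightarrow> (real^'m) \<times> (real^2^'m) \<Rightarrow> (real^'m) \<times> (real^2^'m)" where
  "dual_hessian H a v = (inv H (fst v), snd v /\<^sub>R a)"

lemma pos_definite_dual_hessian:
  assumes "pos_definite H" and "a > 0"
  shows "pos_definite (dual_hessian (H :: real^'m::finite \<Rightarrow> _) a)"
proof -
  have lin: "linear (inv H)" and sym: "\<And>x y. inv H x \<bullet> y = x \<bullet> inv H y"
    and pos: "\<And>x. x \<noteq> 0 \<Longrightarrow> inv H x \<bullet> x > 0"
    using pos_definite_inv[OF assms(1)] unfolding pos_definite_def by blast+
  have nonneg: "inv H x \<bullet> x \<ge> 0" for x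
    using pos[of x] by (cases "x = 0") auto
  have "linear (dual_hessian H a)"
    by (rule linearI) (simp_all add: dual_hessian_def linear_add[OF lin] linear_cmul[OF lin] algebra_simps)
  moreover have "dual_hessian H a x \<bullet> y = x \<bullet> dual_hessian H a y" for x y
    by (simp add: dual_hessian_def inner_prod_def sym)
  moreover have "dual_hessian H a x \<bullet> x > 0" if "x \<noteq> 0" for x
  proof (cases "fst x = 0")
    case True
    then have "snd x \<noteq> 0" using that by (simp add: prod_eq_iff)
    then show ?thesis
      using True \<open>a > 0\<close> by (simp add: dual_hessian_def inner_prod_def)
  next
    case False
    then show ?thesis
      using pos[OF False] \<open>a > 0\<close>
      by (simp add: dual_hessian_def inner_prod_def add_pos_nonneg)
  qed
  ultimately show ?thesis by (simp add: pos_definite_def)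
qed

lemma dual_h_eq_quadratic:
  "dual_h H f0 a v = 1/2 * (dual_hessian H a v \<bullet> v) - 1/2 * (norm f0)\<^sup>2"
  by (cases v) (simp add: dual_h_def dual_hessian_def power2_norm_eq_inner field_simps)

text \<open>
  The linear term of the expansion at \<open>x'\<close> is \<open>P (A x' - b) \<bullet> A (x - x')\<close>. It depends on \<open>x'\<close> only
  through \<open>A x'\<close>, so for \<open>A x' = A xb\<close> it is given by the gradient at \<open>xb\<close>. This is what transports
  the multipliers from \<open>xb\<close> to all nearby minimizers.
\<close>

lemma quadratic_taylor_from_gradient:
  fixes A :: "'a::euclidean_space \<Rightarrow> 'b::euclidean_space" and P :: "'b \<Rightarrow> 'b"
  assumes P: "linear P" "\<And>x y. P x \<bullet> y = x \<bullet> P y" and A: "linear A"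
    and \<phi>: "\<And>x. \<phi> x = 1/2 * (P (A x - b) \<bullet> (A x - b)) + k"
    and grad: "GDERIV \<phi> xb :> g"
    and x': "A x' = A xb"
  shows "\<phi> x = \<phi> x' + g \<bullet> (x - x') + 1/2 * (P (A (x - x')) \<bullet> A (x - x'))"
proof -
  note bl = P(1) A
  have dA: "(A has_derivative A) (at xb)" and dP: "(P has_derivative P) (at y)" for y
    using bl by (auto intro: bounded_linear_imp_has_derivative simp: linear_conv_bounded_linear)
  have dAb: "((\<lambda>x. A x - b) has_derivative A) (at xb)"
    using has_derivative_diff[OF dA has_derivative_const] by simp
  have "((\<lambda>x. P (A x - b)) has_derivative (\<lambda>h. P (A h))) (at xb)"
    using has_derivative_compose[OF dAb dP] .
  then have "(\<phi> has_derivative (\<lambda>h. 1/2 * (P (A xb - b) \<bullet> A h + P (A h) \<bullet> (A xb - b)) + 0)) (at xb)"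
    unfolding \<phi> by (intro derivative_intros dAb)
  moreover have "(\<phi> has_derivative (\<lambda>h. h \<bullet> g)) (at xb)"
    using grad by (simp add: gderiv_def)
  ultimately have "(\<lambda>h. 1/2 * (P (A xb - b) \<bullet> A h + P (A h) \<bullet> (A xb - b)) + 0) = (\<lambda>h. h \<bullet> g)"
    by (rule has_derivative_unique)
  then have "1/2 * (P (A xb - b) \<bullet> A h + P (A h) \<bullet> (A xb - b)) + 0 = h \<bullet> g" for h
    by meson
  moreover have "P (A h) \<bullet> (A xb - b) = P (A xb - b) \<bullet> A h" for h
    by (simp add: P(2) inner_commute)
  ultimately have g: "P (A xb - b) \<bullet> A h = g \<bullet> h" for h
    by (simp add: inner_commute)
  define u d where "u = A xb - b" and "d = A (x - x')"
  have Ax: "A x - b = u + d"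
    using x' A by (simp add: u_def d_def linear_diff)
  have cross: "P d \<bullet> u = P u \<bullet> d"
    by (metis P(2) inner_commute)
  have "\<phi> x - \<phi> x' = 1/2 * (P (u + d) \<bullet> (u + d)) - 1/2 * (P u \<bullet> u)"
    unfolding \<phi> Ax x' u_def[symmetric] by simp
  also have "\<dots> = P u \<bullet> d + 1/2 * (P d \<bullet> d)"
    using P(1) by (simp add: linear_add inner_add_left inner_add_right cross field_simps)
  finally show ?thesis
    using g[of "x - x'"] by (simp add: u_def d_def)
qed

section \<open>The first order condition\<close>

text \<open>
  If the normality inequality failed, \<open>\<phi>\<close> would strictly decrease along the segment from \<open>xb\<close> to some \<open>y\<close> in \<open>C\<close>, which
  lies in \<open>C\<close> by convexity.
\<close>

lemma minimizer_gradient_in_normal_cone: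
  fixes \<phi> :: "'a::real_inner \<Rightarrow> real"
  assumes grad: "GDERIV \<phi> xb :> - w" and "convex C" and "xb \<in> C"
    and min: "\<And>y. y \<in> C \<Longrightarrow> \<phi> xb \<le> \<phi> y"
  shows "w \<in> normal_cone C xb"
proof -
  have "w \<bullet> (y - xb) \<le> 0" if "y \<in> C" for y
  proof (rule ccontr)
    assume neg: "\<not> w \<bullet> (y - xb) \<le> 0"
    let ?p = "\<lambda>t. \<phi> (xb + t *\<^sub>R (y - xb))"
    have "((\<lambda>t. xb + t *\<^sub>R (y - xb)) has_derivative (\<lambda>t. t *\<^sub>R (y - xb))) (at (0::real))"
      by (auto intro!: derivative_eq_intros)
    moreover have "(\<phi> has_derivative (\<lambda>h. h \<bullet> (- w))) (at (xb + 0 *\<^sub>R (y - xb)))"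
      using grad by (simp add: gderiv_def)
    ultimately have "(?p has_derivative (\<lambda>t. (t *\<^sub>R (y - xb)) \<bullet> (- w))) (at 0)"
      by (rule has_derivative_compose)
    moreover have "(\<lambda>t. (t *\<^sub>R (y - xb)) \<bullet> (- w)) = (*) (- (w \<bullet> (y - xb)))"
      by (auto simp: inner_commute)
    ultimately have "(?p has_real_derivative - (w \<bullet> (y - xb))) (at 0)"
      by (simp only: has_field_derivative_def)
    then obtain d where d: "d > 0" "\<And>t. 0 < t \<Longrightarrow> t < d \<Longrightarrow> ?p t < ?p 0"
      using DERIV_neg_dec_right[of ?p "- (w \<bullet> (y - xb))" 0] neg by auto
    define t where "t = min (d / 2) 1"
    have t: "0 < t" "t < d" "t \<le> 1" using \<open>d > 0\<close> by (auto simp: t_def)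
    have "xb + t *\<^sub>R (y - xb) = (1 - t) *\<^sub>R xb + t *\<^sub>R y"
      by (simp add: algebra_simps)
    also have "\<dots> \<in> C"
      using \<open>convex C\<close> \<open>xb \<in> C\<close> that t by (simp add: convex_alt)
    finally have "?p 0 \<le> ?p t" using min by simp
    then show False using d(2)[OF t(1,2)] by simp
  qed
  then show ?thesis using \<open>xb \<in> C\<close> by (simp add: normal_cone_def)
qed

section \<open>Distance to an affine solution set\<close>

text \<open>
  Take for \<open>x'\<close> the orthogonal projection of \<open>x\<close> onto the fibre of \<open>L\<close> through \<open>xb\<close>. Then \<open>x - x'\<close> is
  orthogonal to the kernel of \<open>L\<close>, where \<open>L\<close> is injective and therefore bounded below. The bound on
  \<open>norm (x' - xb)\<close> keeps the projection of a nearby point nearby.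
\<close>

lemma affine_error_bound:
  fixes L :: "'a::euclidean_space \<Rightarrow> 'b::euclidean_space"
  assumes L: "linear L"
  shows "\<exists>e>0. \<forall>x. \<exists>x'. L x' = L xb \<and> norm (x' - xb) \<le> norm (x - xb)
           \<and> e * norm (x - x') \<le> norm (L (x - x'))"
proof -
  define N where "N = {z. L z = 0}"
  define M where "M = {u. \<forall>z\<in>N. orthogonal z u}"
  have N: "subspace N"
    unfolding N_def using L by (rule linear_subspace_kernel)
  have M: "subspace M"
    unfolding M_def by (rule subspace_orthogonal_to_vectors)
  have "u = 0" if "u \<in> M" "L u = 0" for u
    using that by (auto simp: M_def N_def orthogonal_def)
  then obtain e where "e > 0" and e: "\<And>u. u \<in> M \<Longrightarrow> e * norm u \<le> norm (L u)"
    using injective_imp_isometric[OF closed_subspace[OF M] M, of L] L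
    by (auto simp: linear_conv_bounded_linear)
  have "\<exists>x'. L x' = L xb \<and> norm (x' - xb) \<le> norm (x - xb) \<and> e * norm (x - x') \<le> norm (L (x - x'))"
    for x
  proof -
    obtain z u where z: "z \<in> span N" and u: "\<And>y. y \<in> span N \<Longrightarrow> orthogonal u y"
      and x: "x - xb = z + u"
      using orthogonal_subspace_decomp_exists[of N "x - xb"] by blast
    have "L (xb + z) = L xb"
      using z N L by (simp add: span_eq_iff[THEN iffD2] N_def linear_add)
    moreover have "norm z \<le> norm (x - xb)"
    proof -
      have "(norm (x - xb))\<^sup>2 = (norm z)\<^sup>2 + (norm u)\<^sup>2"
        unfolding x using u[OF z] by (intro norm_add_Pythagorean) (simp add: orthogonal_commute)
      then show ?thesis by (simp add: power2_le_imp_le)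
    qed
    moreover have "e * norm (x - (xb + z)) \<le> norm (L (x - (xb + z)))"
    proof -
      have "x - (xb + z) = u"
        using x by (simp add: algebra_simps)
      moreover have "u \<in> M"
        unfolding M_def using u by (simp add: span_base orthogonal_commute)
      ultimately show ?thesis using e by simp
    qed
    ultimately show ?thesis by (intro exI[of _ "xb + z"]) simp
  qed
  then show ?thesis using \<open>e > 0\<close> by blast
qed

section \<open>Quadratics over products of balls\<close>

text \<open>
  The linear map \<open>L\<close> in the proof collects \<open>A\<close> and the active components; its fibre through
  \<open>xb\<close> is, locally, a set of minimizers. Along a displacement from this fibre, \<open>A\<close> is
  controlled by the second order term and the active components by the first order term, so together
  they control \<open>(norm (L (x - x')))\<^sup>2\<close>, and by the error bound \<open>(norm (x - x'))\<^sup>2\<close>.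
\<close>

theorem quadratic_over_ball_products_subregular:
  fixes A :: "('v::euclidean_space^'i::finite) \<times> ('w::euclidean_space^'j::finite) \<Rightarrow> 'b::euclidean_space"
    and xb w :: "('v^'i) \<times> ('w^'j)" and \<alpha> \<beta> :: real
  defines "C \<equiv> {x. (\<forall>i. norm (fst x $ i) \<le> \<alpha>) \<and> (\<forall>j. norm (snd x $ j) \<le> \<beta>)}"
  assumes "\<alpha> > 0" and "\<beta> > 0"
    and P: "pos_definite P" and A: "linear A"
    and \<phi>: "\<And>x. \<phi> x = 1/2 * (P (A x - b) \<bullet> (A x - b)) + k"
    and min: "\<And>y. y \<in> C \<Longrightarrow> \<phi> xb \<le> \<phi> y"
    and grad: "GDERIV \<phi> xb :> - w"
    and strict1: "\<And>i. norm (fst xb $ i) < \<alpha> \<or> norm (fst xb $ i) = \<alpha> \<and>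
                   fst w $ i \<noteq> 0 \<and> fst w $ i \<in> normal_cone (cball 0 \<alpha>) (fst xb $ i)"
    and strict2: "\<And>j. norm (snd xb $ j) < \<beta> \<or> norm (snd xb $ j) = \<beta> \<and>
                   snd w $ j \<noteq> 0 \<and> snd w $ j \<in> normal_cone (cball 0 \<beta>) (snd xb $ j)"
  shows "metrically_subregular (subdifferential (\<lambda>x. ereal (\<phi> x) + indicat_ereal C x)) xb 0"
proof -
  define I where "I = {i. norm (fst xb $ i) = \<alpha>}"
  define J where "J = {j. norm (snd xb $ j) = \<beta>}"
  have le: "norm (fst xb $ i) \<le> \<alpha>" "norm (snd xb $ j) \<le> \<beta>" for i j
    using strict1[of i] strict2[of j] by auto
  then have xb: "xb \<in> C" by (simp add: C_def)
  have "C = {l. \<forall>i. l $ i \<in> cball 0 \<alpha>} \<times> {m. \<forall>j. m $ j \<in> cball 0 \<beta>}"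
    by (auto simp: C_def)
  moreover have "convex {l :: 'v^'i. \<forall>i. l $ i \<in> cball 0 \<alpha>}"
    by (rule convexI) (simp only: mem_Collect_eq vector_add_component vector_scaleR_component
        convexD[OF convex_cball] simp_thms)
  moreover have "convex {m :: 'w^'j. \<forall>j. m $ j \<in> cball 0 \<beta>}"
    by (rule convexI) (simp only: mem_Collect_eq vector_add_component vector_scaleR_component
        convexD[OF convex_cball] simp_thms)
  ultimately have "convex C"
    by (simp add: convex_Times)
  then have w: "w \<bullet> (y - xb) \<le> 0" if "y \<in> C" for y
    using minimizer_gradient_in_normal_cone[OF grad _ xb min] that by (simp add: normal_cone_def)
  have "fst w $ i = 0" if "i \<notin> I" for i
  proof (rule normal_component_zero_at_interior)
    show "fst w \<bullet> (y - fst xb) \<le> 0" if "\<forall>i. norm (y $ i) \<le> \<alpha>" for y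
      using w[of "(y, snd xb)"] that le by (simp add: C_def inner_prod_def)
    show "norm (fst xb $ i) < \<alpha>" using that le(1)[of i] by (simp add: I_def)
  qed (rule le)
  then obtain c1 where "c1 > 0" and c1: "\<And>x x'. \<forall>i. norm (x $ i) \<le> \<alpha> \<Longrightarrow> active_part I x' = active_part I (fst xb) \<Longrightarrow>
      c1 * (norm (active_part I (x - x')))\<^sup>2 \<le> fst w \<bullet> (x' - x)"
    using ball_product_strong_normal[of \<alpha> I "fst xb" "fst w"] \<open>\<alpha> > 0\<close> strict1
    by (force simp: I_def)
  have "snd w $ j = 0" if "j \<notin> J" for j
  proof (rule normal_component_zero_at_interior)
    show "snd w \<bullet> (y - snd xb) \<le> 0" if "\<forall>j. norm (y $ j) \<le> \<beta>" for y
      using w[of "(fst xb, y)"] that le by (simp add: C_def inner_prod_def)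
    show "norm (snd xb $ j) < \<beta>" using that le(2)[of j] by (simp add: J_def)
  qed (rule le)
  then obtain c2 where "c2 > 0" and c2: "\<And>x x'. \<forall>j. norm (x $ j) \<le> \<beta> \<Longrightarrow> active_part J x' = active_part J (snd xb) \<Longrightarrow>
      c2 * (norm (active_part J (x - x')))\<^sup>2 \<le> snd w \<bullet> (x' - x)"
    using ball_product_strong_normal[of \<beta> J "snd xb" "snd w"] \<open>\<beta> > 0\<close> strict2
    by (force simp: J_def)
  obtain c3 where "c3 > 0" and c3: "\<And>v. c3 * (norm v)\<^sup>2 \<le> P v \<bullet> v"
    using pos_definite_coercive[OF P] by blast
  obtain r1 where "r1 > 0" and r1: "\<And>x. norm (x - fst xb) < r1 \<Longrightarrow> active_part I x = active_part I (fst xb) \<Longrightarrow>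
      \<forall>i. norm (x $ i) \<le> \<alpha>"
    using ball_product_neighbourhood[of "fst xb" \<alpha> I] le(1) by (force simp: I_def order_less_le)
  obtain r2 where "r2 > 0" and r2: "\<And>x. norm (x - snd xb) < r2 \<Longrightarrow> active_part J x = active_part J (snd xb) \<Longrightarrow>
      \<forall>j. norm (x $ j) \<le> \<beta>"
    using ball_product_neighbourhood[of "snd xb" \<beta> J] le(2) by (force simp: J_def order_less_le)

  define L where "L x = (A x, active_part I (fst x), active_part J (snd x))" for x
  have "linear L"
    by (rule linearI)
      (simp_all add: L_def linear_add[OF A] linear_cmul[OF A] linear_add[OF linear_active_part] linear_cmul[OF linear_active_part])
  then obtain e where "e > 0" and e: "\<And>x. \<exists>x'. L x' = L xb \<and> norm (x' - xb) \<le> norm (x - xb)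
           \<and> e * norm (x - x') \<le> norm (L (x - x'))"
    using affine_error_bound by blast
  have norm_L: "(norm (L x))\<^sup>2 = (norm (A x))\<^sup>2 + (norm (active_part I (fst x)))\<^sup>2 + (norm (active_part J (snd x)))\<^sup>2" for x
    by (simp add: L_def norm_prod_def)
  define c where "c = Min {c1, c2, c3 / 2}"
  have c: "c > 0" "c \<le> c1" "c \<le> c2" "c \<le> c3 / 2"
    using \<open>c1 > 0\<close> \<open>c2 > 0\<close> \<open>c3 > 0\<close> by (auto simp: c_def)

  show ?thesis
  proof (rule subdifferential_quadratic_growth_imp_subregular)
    show "0 \<in> subdifferential (\<lambda>x. ereal (\<phi> x) + indicat_ereal C x) xb"
      using xb min by (simp add: zero_in_subdifferential_indicator_sum_iff)
    show "c * e\<^sup>2 > 0" using \<open>e > 0\<close> c by simp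
    show "min r1 r2 > 0" using \<open>r1 > 0\<close> \<open>r2 > 0\<close> by simp
    fix x assume near: "dist xb x < min r1 r2" and "\<bar>ereal (\<phi> x) + indicat_ereal C x\<bar> \<noteq> \<infinity>"
    then have x: "x \<in> C"
      by (auto simp: indicat_ereal_def split: if_splits)
    obtain x' where Lx': "L x' = L xb" and x'_near: "norm (x' - xb) \<le> norm (x - xb)"
      and x'_err: "e * norm (x - x') \<le> norm (L (x - x'))"
      using e by blast
    have Ax': "A x' = A xb" and mI: "active_part I (fst x') = active_part I (fst xb)"
      and mJ: "active_part J (snd x') = active_part J (snd xb)"
      using Lx' by (simp_all add: L_def)
    have "norm (x' - xb) < min r1 r2"
      using x'_near near by (simp add: dist_norm norm_minus_commute)
    moreover have "norm (fst x' - fst xb) \<le> norm (x' - xb)" "norm (snd x' - snd xb) \<le> norm (x' - xb)"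
      by (simp_all add: norm_prod_def[of "x' - xb"])
    ultimately have x': "x' \<in> C"
      using r1[OF _ mI] r2[OF _ mJ] by (simp add: C_def)
    let ?u = "x - x'"
    have "c * e\<^sup>2 * (norm ?u)\<^sup>2 = c * (e * norm ?u)\<^sup>2"
      by (simp add: power_mult_distrib)
    also have "\<dots> \<le> c * (norm (L ?u))\<^sup>2"
      using x'_err \<open>e > 0\<close> c(1) by (intro mult_left_mono power_mono) auto
    also have "\<dots> = c * (norm (active_part I (fst ?u)))\<^sup>2 + c * (norm (active_part J (snd ?u)))\<^sup>2 + c * (norm (A ?u))\<^sup>2"
      by (simp add: norm_L algebra_simps)
    also have "\<dots> \<le> c1 * (norm (active_part I (fst ?u)))\<^sup>2 + c2 * (norm (active_part J (snd ?u)))\<^sup>2 + c3 / 2 * (norm (A ?u))\<^sup>2"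
      using c by (intro add_mono mult_right_mono) auto
    also have "\<dots> \<le> fst w \<bullet> (fst x' - fst x) + snd w \<bullet> (snd x' - snd x) + 1/2 * (P (A ?u) \<bullet> A ?u)"
      using c1[of "fst x" "fst x'"] c2[of "snd x" "snd x'"] c3[of "A ?u"] x mI mJ
      by (simp add: C_def)
    also have "\<dots> = - w \<bullet> ?u + 1/2 * (P (A ?u) \<bullet> A ?u)"
      by (simp add: inner_prod_def inner_diff_right)
    also have "\<dots> = \<phi> x - \<phi> x'"
    proof -
      have "\<phi> x = \<phi> x' + - w \<bullet> ?u + 1/2 * (P (A ?u) \<bullet> A ?u)"
        using P unfolding pos_definite_def
        by (intro quadratic_taylor_from_gradient[OF _ _ A \<phi> grad Ax']) blast+
      then show ?thesis by linarith
    qed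
    finally have growth: "\<phi> x' + c * e\<^sup>2 * (norm ?u)\<^sup>2 \<le> \<phi> x" by simp
    have "\<phi> x' = \<phi> xb" using \<phi> Ax' by simp
    then have "0 \<in> subdifferential (\<lambda>x. ereal (\<phi> x) + indicat_ereal C x) x'"
      using x' min by (simp add: zero_in_subdifferential_indicator_sum_iff)
    with growth x x' show "\<exists>x'. 0 \<in> subdifferential (\<lambda>x. ereal (\<phi> x) + indicat_ereal C x) x' \<and>
        ereal (\<phi> x') + indicat_ereal C x' + ereal (c * e\<^sup>2 * (norm (x - x'))\<^sup>2)
          \<le> ereal (\<phi> x) + indicat_ereal C x"
      by (intro exI[of _ x']) (simp add: indicat_ereal_def)
  qed
qed

section \<open>The dual problem\<close>

theorem theorem2:
  fixes \<alpha>0 \<alpha>1 a \<nu> :: real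
    and px :: "'m::finite \<Rightarrow> nat \<times> nat" and N1 N2 :: nat
    and K :: "real^'m \<Rightarrow> real^'k::finite"
    and f0 :: "real^'k"
    and A :: "(real^2^'m) \<times> (sym2^'m) \<Rightarrow> (real^'m) \<times> (real^2^'m)"
    and b :: "(real^'m) \<times> (real^2^'m)"
    and lbar gbar :: "real^2^'m" and mbar pbar :: "sym2^'m"
  assumes "\<alpha>0 > 0" and "\<alpha>1 > 0" and "a > 0"
    and "inj px" and "range px = {..<N1} \<times> {..<N2}"
    and "linear K"
    and "if pos_definite (\<lambda>u. adjoint K (K u)) then \<nu> = 0 else \<nu> > 0"
    and "pos_definite (H_op K \<nu> px)"
    and "linear A"
    and solution: "\<forall>\<xi>. - dual_objective (H_op K \<nu> px) f0 a \<alpha>0 \<alpha>1 A b \<xi>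
                      \<le> - dual_objective (H_op K \<nu> px) f0 a \<alpha>0 \<alpha>1 A b (lbar, mbar)"
    and multipliers: "GDERIV (\<lambda>\<xi>. dual_h (H_op K \<nu> px) f0 a (A \<xi> - b)) (lbar, mbar) :> - (gbar, pbar)"
    and "\<forall>i. lbar $ i \<in> interior (cball 0 \<alpha>1) \<or>
             lbar $ i \<in> frontier (cball 0 \<alpha>1) \<and>
               gbar $ i \<noteq> 0 \<and> gbar $ i \<in> normal_cone (cball 0 \<alpha>1) (lbar $ i)"
    and "\<forall>i. mbar $ i \<in> interior (cball 0 \<alpha>0) \<or>
             mbar $ i \<in> frontier (cball 0 \<alpha>0) \<and>
               pbar $ i \<noteq> 0 \<and> pbar $ i \<in> normal_cone (cball 0 \<alpha>0) (mbar $ i)"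
  shows "metrically_subregular
           (subdifferential (dual_objective (H_op K \<nu> px) f0 a \<alpha>0 \<alpha>1 A b)) (lbar, mbar) 0"
proof -
  let ?H = "H_op K \<nu> px"
  let ?\<phi> = "\<lambda>\<xi>. dual_h ?H f0 a (A \<xi> - b)"
  let ?C = "{\<xi> :: (real^2^'m) \<times> (sym2^'m). (\<forall>i. norm (fst \<xi> $ i) \<le> \<alpha>1) \<and> (\<forall>i. norm (snd \<xi> $ i) \<le> \<alpha>0)}"
  have D: "dual_objective ?H f0 a \<alpha>0 \<alpha>1 A b = (\<lambda>\<xi>. ereal (?\<phi> \<xi>) + indicat_ereal ?C \<xi>)"
    by (auto simp: dual_objective_def indicat_ereal_def fun_eq_iff)
  have strict1: "norm (lbar $ i) < \<alpha>1 \<or> norm (lbar $ i) = \<alpha>1 \<and>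
      gbar $ i \<noteq> 0 \<and> gbar $ i \<in> normal_cone (cball 0 \<alpha>1) (lbar $ i)" for i
    using assms(12)[rule_format, of i] by auto
  have strict2: "norm (mbar $ i) < \<alpha>0 \<or> norm (mbar $ i) = \<alpha>0 \<and>
      pbar $ i \<noteq> 0 \<and> pbar $ i \<in> normal_cone (cball 0 \<alpha>0) (mbar $ i)" for i
    using assms(13)[rule_format, of i] by auto
  have feasible: "(lbar, mbar) \<in> ?C"
    using strict1 strict2 by (auto simp: le_less)
  show ?thesis
    unfolding D
  proof (rule quadratic_over_ball_products_subregular)
    show "pos_definite (dual_hessian ?H a)"
      by (rule pos_definite_dual_hessian) fact+
    show "?\<phi> \<xi> = 1/2 * (dual_hessian ?H a (A \<xi> - b) \<bullet> (A \<xi> - b)) + (- (1/2 * (norm f0)\<^sup>2))" for \<xi>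
      by (simp add: dual_h_eq_quadratic)
    show "?\<phi> (lbar, mbar) \<le> ?\<phi> \<xi>" if "\<xi> \<in> ?C" for \<xi>
      using solution[rule_format, of \<xi>] that feasible by (simp add: D indicat_ereal_def)
    show "GDERIV ?\<phi> (lbar, mbar) :> - (gbar, pbar)" by (fact multipliers)
  qed (use assms(1,2,9) strict1 strict2 in simp_all)
qed

end
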